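(* Let $p$ be an odd prime, $1\le m\le n$, and let $I$ be the generalized order ideal of $\mathbb{GH}(m,n)$, of saturated or unsaturated type, in which every element of $[n]$ has multiplicity $p-1$ (i.e. all multiplicities lie in $\{0,p-1\}$ and the support of $I$ is $[n]$). Let $f:\mathbb{F}_p^n\to\mathbb{F}_p$ be the characteristic function of $I(\mathbb{GP})\setminus\{0\}$ and \[ \mathcal{C}_f=\{(sf(x)+u\cdot x)_{x\in\mathbb{F}_p^n\setminus0}:\ s\in\mathbb{F}_p,\ u\in\mathbb{F}_p^n\}. \] If $m=1$, then $\mathcal{C}_f$ is not minimal for either notion (saturated or unsaturated). If $m=n-1\ge2$ and the notion is saturated, then $\mathcal{C}_f$ is not minimal.
   Context: $[n]=\{1,\dots,n\}$; $u\cdot x=\sum_i u_ix_i$. A nonzero codeword $c$ of a linear code $\mathcal{C}$ over $\mathbb{F}_p$ is minimal if $c'\in\mathcal{C}$ and $\mathrm{supp}(c')\subseteq\mathrm{supp}(c)$ imply $c'\in\mathbb{F}_pc$; $\mathcal{C}$ is minimal if all its nonzero codewords are. Generalized order ideals: $[n]_{p-1}$ is the multiset in which each $i\in[n]$ has multiplicity $p-1$. A sub-multiset $J$ is identified with its multiplicity vector $(J_1,\dots,J_n)\in\{0,\dots,p-1\}^n=\mathbb{F}_p^n$; $J\subseteq J'$ means $J_i\le J'_i$ (as integers) for all $i$; $\bar J=\{i:J_i\ne0\}$. The hierarchical poset $\mathbb{H}(m,n)$ on $[n]$ has as its only strict relations $i\prec j$ for all $i\in[m]$, $j\in[n]\setminus[m]$;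 $\mathbb{GH}(m,n)$ denotes $[n]_{p-1}$ together with this order. $J$ is an unsaturated generalized order ideal if $\bar J$ is an order ideal (down-closed subset) of $\mathbb{H}(m,n)$; it is a saturated generalized order ideal if moreover $J_i=p-1$ whenever $j\in\bar J$ and $i\prec j$. For a generalized order ideal $I$ of either type, $I(\mathbb{GP})\subseteq\mathbb{F}_p^n$ is the set of all generalized order ideals of the same type contained in $I$. *)

theory Defs
  imports
    "HOL-Library.FuncSet"
    "HOL-Library.Indicator_Function"
    "HOL-Library.Multiset"
    "Berlekamp_Zassenhaus.Finite_Field"
begin

section \<open>Minimal codes\<close>

text \<open>
  A word with coordinate set \<open>D\<close> is an element of \<open>D \<rightarrow>\<^sub>E UNIV\<close>. The definitions below are meant
  for codes \<open>C\<close> that are linear subspaces of \<open>D \<rightarrow>\<^sub>E UNIV\<close>, with operations taken pointwise on \<open>D\<close>.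
\<close>

definition supp :: "'x set \<Rightarrow> ('x \<Rightarrow> 'a::field) \<Rightarrow> 'x set" where
  "supp D c = {x \<in> D. c x \<noteq> 0}"

definition minimal_codeword :: "'x set \<Rightarrow> ('x \<Rightarrow> 'a::field) set \<Rightarrow> ('x \<Rightarrow> 'a) \<Rightarrow> bool" where
  "minimal_codeword D C c \<longleftrightarrow>
     c \<in> C \<and> c \<noteq> (\<lambda>x\<in>D. 0) \<and>
     (\<forall>c'\<in>C. supp D c' \<subseteq> supp D c \<longrightarrow> (\<exists>a. c' = (\<lambda>x\<in>D. a * c x)))"

definition minimal_code :: "'x set \<Rightarrow> ('x \<Rightarrow> 'a::field) set \<Rightarrow> bool" where
  "minimal_code D C \<longleftrightarrow> (\<forall>c\<in>C. c \<noteq> (\<lambda>x\<in>D. 0) \<longrightarrow> minimal_codeword D C c)"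


section \<open>The code of a function on the space of n-tuples\<close>

text \<open>
  Vectors of length \<open>n\<close> are extensional functions on the index set \<open>{1..n}\<close>.
\<close>

definition vecs :: "nat \<Rightarrow> (nat \<Rightarrow> 'a::field) set" where
  "vecs n = {1..n} \<rightarrow>\<^sub>E UNIV"

definition zero_vec :: "nat \<Rightarrow> nat \<Rightarrow> 'a::field" where
  "zero_vec n = (\<lambda>i\<in>{1..n}. 0)"

definition dot :: "nat \<Rightarrow> (nat \<Rightarrow> 'a::field) \<Rightarrow> (nat \<Rightarrow> 'a) \<Rightarrow> 'a" where
  "dot n u x = (\<Sum>i\<in>{1..n}. u i * x i)"

definition nonzero_vecs :: "nat \<Rightarrow> (nat \<Rightarrow> 'a::field) set" where
  "nonzero_vecs n = vecs n - {zero_vec n}"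

definition code_of :: "nat \<Rightarrow> ((nat \<Rightarrow> 'a) \<Rightarrow> 'a::field) \<Rightarrow> ((nat \<Rightarrow> 'a) \<Rightarrow> 'a) set" where
  "code_of n f = {\<lambda>x\<in>nonzero_vecs n. s * f x + dot n u x | s u. u \<in> vecs n}"


section \<open>Generalized order ideals of the hierarchical poset\<close>

definition hier_less :: "nat \<Rightarrow> nat \<Rightarrow> nat \<Rightarrow> nat \<Rightarrow> bool" where
  "hier_less m n i j \<longleftrightarrow> i \<in> {1..m} \<and> j \<in> {1..n} - {1..m}"

definition hier_order_ideal :: "nat \<Rightarrow> nat \<Rightarrow> nat set \<Rightarrow> bool" where
  "hier_order_ideal m n A \<longleftrightarrow>
     A \<subseteq> {1..n} \<and> (\<forall>j\<in>A. \<forall>i. hier_less m n i j \<longrightarrow> i \<in> A)"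

definition ambient_mset :: "nat \<Rightarrow> nat \<Rightarrow> nat multiset" where
  "ambient_mset p n = (\<Sum>i\<in>{1..n}. replicate_mset (p - 1) i)"

datatype ideal_type = Saturated | Unsaturated

fun gen_order_ideal :: "ideal_type \<Rightarrow> nat \<Rightarrow> nat \<Rightarrow> nat \<Rightarrow> nat multiset \<Rightarrow> bool" where
  "gen_order_ideal Unsaturated p m n J \<longleftrightarrow>
     J \<subseteq># ambient_mset p n \<and> hier_order_ideal m n (set_mset J)"
| "gen_order_ideal Saturated p m n J \<longleftrightarrow>
     J \<subseteq># ambient_mset p n \<and> hier_order_ideal m n (set_mset J) \<and>
     (\<forall>i j. j \<in> set_mset J \<and> hier_less m n i j \<longrightarrow> count J i = p - 1)"

text \<open>
  The type \<open>'p mod_ring\<close> with \<open>'p::prime_card\<close> is the field with \<open>p = CARD('p)\<close> elements, so a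
  sub-multiset of \<open>ambient_mset p n\<close> is determined by the residues of its multiplicities.
\<close>

definition mult_vec :: "nat \<Rightarrow> nat multiset \<Rightarrow> nat \<Rightarrow> 'p::prime_card mod_ring" where
  "mult_vec n J = (\<lambda>i\<in>{1..n}. of_nat (count J i))"

definition ideals_below ::
    "ideal_type \<Rightarrow> nat \<Rightarrow> nat \<Rightarrow> nat multiset \<Rightarrow> (nat \<Rightarrow> 'p::prime_card mod_ring) set" where
  "ideals_below t m n I =
     mult_vec n ` {J. gen_order_ideal t CARD('p) m n J \<and> J \<subseteq># I}"

end

theory Submission
  imports Defs
begin

text \<open>
  A code is not minimal as soon as it has two codewords \<open>c\<close> and \<open>c'\<close> with
  \<open>supp c' \<subseteq> supp c\<close> that are not proportional, and such pairs can be written down explicitly.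
  The multiset \<open>I\<close> imposes no restriction, so that \<open>ideals_below t m n I\<close> is a set of vectors
  described coordinatewise (\<open>ideals_below_ambient\<close>); let \<open>f\<close> be the indicator function of its
  nonzero members.

  If \<open>m = 1\<close>, a nonempty order ideal contains \<open>1\<close>, so \<open>f\<close> is supported inside
  \<open>{x. x\<^sub>1 \<noteq> 0}\<close>, the support of the codeword \<open>x\<^sub>1\<close>. Both \<open>e\<^sub>1\<close> and \<open>2 e\<^sub>1\<close> are order ideals for
  either notion, so \<open>f\<close> takes the value \<open>1\<close> at both of them, while \<open>x\<^sub>1\<close> takes the distinct
  values \<open>1\<close> and \<open>2\<close>; since \<open>p\<close> is odd, \<open>2 e\<^sub>1\<close> is nonzero. Hence \<open>x\<^sub>1\<close> is not minimal.

  If \<open>m = n - 1 \<ge> 2\<close> in the saturated case, \<open>f = 1\<close> on the nonzero vectors with \<open>x\<^sub>n = 0\<close>, and for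
  \<open>x\<^sub>n \<noteq> 0\<close> the value of \<open>f\<close> is nonzero only if \<open>x\<^sub>i = -1\<close> for all \<open>i < n\<close>. The codeword
  \<open>f + x\<^sub>n\<close> therefore vanishes only at \<open>(-1, \<dots>, -1)\<close>, where \<open>x\<^sub>1 - x\<^sub>2\<close> vanishes as well. The two
  codewords are not proportional, since at \<open>e\<^sub>1\<close> and \<open>e\<^sub>1 + e\<^sub>2\<close> the former takes the values
  \<open>1, 1\<close> and the latter \<open>1, 0\<close>.
\<close>

section \<open>Codewords and vectors\<close>

lemma not_minimal_codeI:
  assumes "c \<in> C" "c' \<in> C" "supp D c' \<subseteq> supp D c"
    and "x \<in> D" "y \<in> D" "c x * c' y \<noteq> c y * c' x"
  shows "\<not> minimal_code D C"
proof
  assume min: "minimal_code D C"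
  have "c \<noteq> (\<lambda>x\<in>D. 0)"
    using assms(4-6) by auto
  with min assms(1-3) obtain a where "c' = (\<lambda>x\<in>D. a * c x)"
    unfolding minimal_code_def minimal_codeword_def by blast
  with assms(4-6) show False
    by (simp add: mult_ac)
qed

lemma code_ofI:
  assumes "u \<in> vecs n"
  shows "(\<lambda>x\<in>nonzero_vecs n. s * f x + dot n u x) \<in> code_of n f"
  using assms unfolding code_of_def by blast

lemma vecs_restrict: "(\<lambda>i\<in>{1..n}. g i) \<in> vecs n"
  by (simp add: vecs_def)

lemma zero_vec_in_vecs: "zero_vec n \<in> vecs n"
  unfolding zero_vec_def by (rule vecs_restrict)

lemma nonzero_vecs_iff:
  "x \<in> nonzero_vecs n \<longleftrightarrow> x \<in> vecs n \<and> (\<exists>i\<in>{1..n}. x i \<noteq> 0)"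
proof -
  have "x = zero_vec n \<longleftrightarrow> (\<forall>i\<in>{1..n}. x i = 0)" if "x \<in> vecs n"
  proof
    assume "\<forall>i\<in>{1..n}. x i = 0"
    with that show "x = zero_vec n"
      unfolding vecs_def by (intro PiE_ext) (auto simp: zero_vec_def)
  qed (simp add: zero_vec_def)
  then show ?thesis
    unfolding nonzero_vecs_def by auto
qed

lemma dot_zero_vec: "dot n (zero_vec n) x = 0"
  unfolding dot_def zero_vec_def by (intro sum.neutral) auto

section \<open>Generalized order ideals as vectors\<close>

lemma count_sum_replicate_mset:
  assumes "finite A"
  shows "count (\<Sum>i\<in>A. replicate_mset (k i) i) j = (if j \<in> A then k j else 0)"
  using assms by (induction A rule: finite_induct) auto

lemma count_ambient_mset:
  "count (ambient_mset p n) j = (if j \<in> {1..n} then p - 1 else 0)"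
  unfolding ambient_mset_def by (subst count_sum_replicate_mset) auto

lemma subset_ambient_mset_iff:
  "J \<subseteq># ambient_mset p n \<longleftrightarrow>
     (\<forall>i\<in>{1..n}. count J i \<le> p - 1) \<and> (\<forall>i. i \<notin> {1..n} \<longrightarrow> count J i = 0)"
  unfolding subseteq_mset_def by (auto simp: count_ambient_mset split: if_splits)

lemma inj_on_of_nat_mod_ring:
  "inj_on (of_nat :: nat \<Rightarrow> 'p::prime_card mod_ring) {..<CARD('p)}"
  by (rule inj_onI) (auto simp: of_nat_eq_iff_cong_CHAR cong_def)

lemma of_nat_card_minus_1: "of_nat (CARD('p) - 1) = (- 1 :: 'p::prime_card mod_ring)"
proof -
  have "of_nat (CARD('p) - 1) + 1 = (of_nat CARD('p) :: 'p mod_ring)"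
    by (metis One_nat_def Suc_pred of_nat_Suc add.commute zero_less_card_finite)
  then show ?thesis
    by (simp add: add_eq_0_iff2)
qed

text \<open>
  Every residue class has a representative below \<open>p\<close>, so every vector is the multiplicity vector
  of a sub-multiset of \<open>ambient_mset p n\<close>.
\<close>

lemma mult_vec_surj:
  fixes x :: "nat \<Rightarrow> 'p::prime_card mod_ring"
  assumes "x \<in> vecs n"
  obtains J where "J \<subseteq># ambient_mset CARD('p) n" "mult_vec n J = x"
proof -
  have "\<exists>k. \<forall>i. k i < CARD('p) \<and> x i = of_nat (k i)"
    using surj_of_nat_mod_ring[where 'a = 'p] by (intro choice) blast
  then obtain k where less: "\<And>i. k i < CARD('p)" and x: "\<And>i. x i = of_nat (k i)"
    by blast
  let ?J = "\<Sum>i\<in>{1..n}. replicate_mset (k i) i"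
  have count: "count ?J j = (if j \<in> {1..n} then k j else 0)" for j
    by (rule count_sum_replicate_mset) simp
  have "k i \<le> CARD('p) - 1" for i
    using less[of i] by linarith
  then have "?J \<subseteq># ambient_mset CARD('p) n"
    unfolding subset_ambient_mset_iff count by simp
  moreover have "mult_vec n ?J = x"
  proof (rule PiE_ext)
    show "mult_vec n ?J \<in> {1..n} \<rightarrow>\<^sub>E UNIV"
      by (simp add: mult_vec_def)
    show "x \<in> {1..n} \<rightarrow>\<^sub>E UNIV"
      using assms by (simp add: vecs_def)
    show "mult_vec n ?J i = x i" if "i \<in> {1..n}" for i
      unfolding mult_vec_def using that count x by simp
  qed
  ultimately show thesis
    using that by blast
qed

text \<open>
  The multiplicity \<open>p - 1\<close> required below a member of a saturated ideal becomes the coordinate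
  \<open>-1\<close>.
\<close>

lemma ideals_below_ambient:
  "ideals_below t m n (ambient_mset CARD('p) n) =
     {x \<in> vecs n. hier_order_ideal m n {i \<in> {1..n}. x i \<noteq> (0 :: 'p::prime_card mod_ring)} \<and>
        (t = Saturated \<longrightarrow>
           (\<forall>j\<in>{1..n}. \<forall>i. x j \<noteq> 0 \<and> hier_less m n i j \<longrightarrow> x i = - 1))}"
    (is "_ = {x \<in> vecs n. ?P x}")
proof -
  have *: "gen_order_ideal t CARD('p) m n J \<longleftrightarrow> ?P (mult_vec n J)"
    if J: "J \<subseteq># ambient_mset CARD('p) n" for J
  proof -
    have less: "count J i < CARD('p)" for i
      using J unfolding subset_ambient_mset_iff
      by (metis One_nat_def Suc_pred le_imp_less_Suc zero_less_card_finite)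
    have eq_iff: "mult_vec n J i = (of_nat k :: 'p mod_ring) \<longleftrightarrow> count J i = k"
      if "i \<in> {1..n}" "k < CARD('p)" for i k
      using that less[of i] inj_on_eq_iff[OF inj_on_of_nat_mod_ring[where 'p = 'p]]
      by (simp add: mult_vec_def)
    have zero: "mult_vec n J i = (0 :: 'p mod_ring) \<longleftrightarrow> i \<notin># J" if "i \<in> {1..n}" for i
      using eq_iff[OF that, of 0] by (simp add: not_in_iff)
    have minus_1: "mult_vec n J i = (- 1 :: 'p mod_ring) \<longleftrightarrow> count J i = CARD('p) - 1"
      if "i \<in> {1..n}" for i
      using eq_iff[OF that, of "CARD('p) - 1"] by (simp add: of_nat_card_minus_1)
    have sub: "set_mset J \<subseteq> {1..n}"
      using J unfolding subset_ambient_mset_iff by (metis not_in_iff subsetI)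
    then have supp: "{i \<in> {1..n}. mult_vec n J i \<noteq> (0 :: 'p mod_ring)} = set_mset J"
      using zero by blast
    have sat: "(\<forall>j\<in>{1..n}. \<forall>i. mult_vec n J j \<noteq> (0 :: 'p mod_ring) \<and> hier_less m n i j \<longrightarrow>
          mult_vec n J i = (- 1 :: 'p mod_ring)) \<longleftrightarrow>
        (\<forall>i j. j \<in># J \<and> hier_less m n i j \<longrightarrow> count J i = CARD('p) - 1)"
      if "hier_order_ideal m n (set_mset J)"
    proof -
      have "i \<in> {1..n}" if "j \<in># J" "hier_less m n i j" for i j
        using that sub \<open>hier_order_ideal m n (set_mset J)\<close> unfolding hier_order_ideal_def by blast
      then show ?thesis
        using supp minus_1 by blast
    qed
    show ?thesis
      unfolding supp using J sat by (cases t) auto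
  qed
  show ?thesis
  proof (intro subset_antisym subsetI)
    fix x :: "nat \<Rightarrow> 'p mod_ring" assume "x \<in> ideals_below t m n (ambient_mset CARD('p) n)"
    then obtain J where "J \<subseteq># ambient_mset CARD('p) n" "gen_order_ideal t CARD('p) m n J"
      and x: "x = mult_vec n J"
      unfolding ideals_below_def by blast
    moreover have "mult_vec n J \<in> vecs n"
      by (simp add: mult_vec_def vecs_def)
    ultimately show "x \<in> {x \<in> vecs n. ?P x}"
      using * by blast
  next
    fix x :: "nat \<Rightarrow> 'p mod_ring" assume x: "x \<in> {x \<in> vecs n. ?P x}"
    then obtain J where "J \<subseteq># ambient_mset CARD('p) n" "mult_vec n J = x"
      using mult_vec_surj by blast
    with x * show "x \<in> ideals_below t m n (ambient_mset CARD('p) n)"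
      unfolding ideals_below_def by blast
  qed
qed

section \<open>Non-proportional codewords with nested supports\<close>

lemma not_minimal_code_if_m_eq_1:
  fixes f :: "(nat \<Rightarrow> 'p::prime_card mod_ring) \<Rightarrow> 'p mod_ring"
  assumes "odd CARD('p)" and "1 \<le> n"
    and f: "f = indicator (ideals_below t 1 n (ambient_mset CARD('p) n) - {zero_vec n})"
  shows "\<not> minimal_code (nonzero_vecs n) (code_of n f)"
proof -
  define e :: "'p mod_ring \<Rightarrow> nat \<Rightarrow> 'p mod_ring"
    where "e a = (\<lambda>i\<in>{1..n}. if i = 1 then a else 0)" for a
  let ?D = "nonzero_vecs n :: (nat \<Rightarrow> 'p mod_ring) set"
  let ?c = "\<lambda>x\<in>?D. 0 * f x + dot n (e 1) x"
  let ?c' = "\<lambda>x\<in>?D. 1 * f x + dot n (zero_vec n) x"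
  have e: "e a \<in> vecs n" for a
    unfolding e_def by (rule vecs_restrict)
  have e1: "e a 1 = a" for a
    using assms(2) by (simp add: e_def)
  have dot: "dot n (e 1) x = x 1" for x
  proof -
    have "dot n (e 1) x = (\<Sum>i\<in>{1}. e 1 i * x i)"
      unfolding dot_def using assms(2) by (intro sum.mono_neutral_right) (auto simp: e_def)
    then show ?thesis
      by (simp add: e1[unfolded One_nat_def])
  qed
  have e_nonzero: "e a \<in> ?D" if "a \<noteq> 0" for a
    using that e assms(2) e1 unfolding nonzero_vecs_iff by (intro conjI bexI[of _ 1]) auto
  have f_e: "f (e a) = 1" if "a \<noteq> 0" for a
  proof -
    have "{i \<in> {1..n}. e a i \<noteq> 0} = {1}"
      using that assms(2) by (auto simp: e_def)
    then have "e a \<in> ideals_below t 1 n (ambient_mset CARD('p) n)"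
      using e assms(2) unfolding ideals_below_ambient
      by (auto simp: hier_order_ideal_def hier_less_def)
    with e_nonzero[OF that] show ?thesis
      unfolding f nonzero_vecs_def by simp
  qed
  have supp: "supp ?D ?c' \<subseteq> supp ?D ?c"
  proof -
    have "x 1 \<noteq> 0" if x: "x \<in> ?D" and "f x \<noteq> 0" for x
    proof -
      have "x \<in> ideals_below t 1 n (ambient_mset CARD('p) n)"
        using \<open>f x \<noteq> 0\<close> unfolding f by (auto simp: indicator_def split: if_splits)
      then have "hier_order_ideal 1 n {i \<in> {1..n}. x i \<noteq> 0}"
        unfolding ideals_below_ambient by blast
      moreover obtain j where "j \<in> {1..n}" "x j \<noteq> 0"
        using x nonzero_vecs_iff by blast
      ultimately show ?thesis
        unfolding hier_order_ideal_def hier_less_def by (cases "j = 1") auto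
    qed
    then show ?thesis
      by (auto simp: supp_def dot dot_zero_vec)
  qed
  have two: "(2 :: 'p mod_ring) \<noteq> 0"
  proof
    assume "(2 :: 'p mod_ring) = 0"
    then have "CARD('p) dvd 2"
      using of_nat_eq_0_iff_char_dvd[of 2, where 'a = "'p mod_ring"] by simp
    then have "CARD('p) = 2"
      using primes_dvd_imp_eq[OF prime_card two_is_prime_nat] by blast
    with assms(1) show False
      by simp
  qed
  have "(1 :: 'p mod_ring) \<noteq> 2"
    by (metis add_cancel_left_right one_add_one zero_neq_one)
  with two have "?c (e 1) * ?c' (e 2) \<noteq> ?c (e 2) * ?c' (e 1)"
    using e_nonzero f_e by (simp add: dot e1[unfolded One_nat_def] dot_zero_vec)
  with supp two show ?thesis
    using e_nonzero[of 1] e_nonzero[of 2]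
    by (intro not_minimal_codeI[of ?c _ ?c' _ "e 1" "e 2"] code_ofI e zero_vec_in_vecs) auto
qed

lemma not_minimal_code_if_m_eq_n_minus_1:
  fixes f :: "(nat \<Rightarrow> 'p::prime_card mod_ring) \<Rightarrow> 'p mod_ring"
  assumes "m = n - 1" and "2 \<le> m"
    and f: "f = indicator (ideals_below Saturated m n (ambient_mset CARD('p) n) - {zero_vec n})"
  shows "\<not> minimal_code (nonzero_vecs n) (code_of n f)"
proof -
  \<comment> \<open>\<open>v a b d\<close> is \<open>a e\<^sub>1 + b e\<^sub>2 + d e\<^sub>n\<close>; it serves both as a point and as a linear form.\<close>
  define v :: "'p mod_ring \<Rightarrow> 'p mod_ring \<Rightarrow> 'p mod_ring \<Rightarrow> nat \<Rightarrow> 'p mod_ring"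
    where "v a b d = (\<lambda>i\<in>{1..n}. if i = 1 then a else if i = 2 then b else if i = n then d else 0)"
    for a b d
  let ?D = "nonzero_vecs n :: (nat \<Rightarrow> 'p mod_ring) set"
  let ?c = "\<lambda>x\<in>?D. 1 * f x + dot n (v 0 0 1) x"
  let ?c' = "\<lambda>x\<in>?D. 0 * f x + dot n (v 1 (-1) 0) x"
  have n: "3 \<le> n" using assms by simp
  have v: "v a b d \<in> vecs n" for a b d
    unfolding v_def by (rule vecs_restrict)
  have v_nth: "v a b d 1 = a" "v a b d 2 = b" "v a b d n = d" for a b d
    using n by (auto simp: v_def)
  have dot: "dot n (v a b d) x = a * x 1 + b * x 2 + d * x n" for a b d x
  proof -
    have "dot n (v a b d) x = (\<Sum>i\<in>{1, 2, n}. v a b d i * x i)"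
      unfolding dot_def using n by (intro sum.mono_neutral_right) (auto simp: v_def)
    then show ?thesis
      using n by (simp add: v_nth v_nth[unfolded One_nat_def] add.assoc)
  qed
  have v_nonzero: "v 1 b d \<in> ?D" for b d
    using v n v_nth unfolding nonzero_vecs_iff by (intro conjI bexI[of _ 1]) auto
  have f_1: "f x = 1" if "x \<in> ?D" "x n = 0" for x
  proof -
    have less_n: "j = n" if "hier_less m n i j" for i j
      using that assms(1) unfolding hier_less_def by auto
    have "x \<in> ideals_below Saturated m n (ambient_mset CARD('p) n)"
      using that less_n unfolding ideals_below_ambient hier_order_ideal_def nonzero_vecs_def
      by blast
    with that show ?thesis
      unfolding f nonzero_vecs_def by simp
  qed
  have x_minus_1: "x i = - 1" if "f x \<noteq> 0" "x n \<noteq> 0" "i \<in> {1..m}" for x i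
  proof -
    have "x \<in> ideals_below Saturated m n (ambient_mset CARD('p) n)"
      using \<open>f x \<noteq> 0\<close> unfolding f by (auto simp: indicator_def split: if_splits)
    moreover have "n \<in> {1..n}" "hier_less m n i n"
      using that assms n unfolding hier_less_def by auto
    ultimately show ?thesis
      using \<open>x n \<noteq> 0\<close> unfolding ideals_below_ambient by blast
  qed
  have "supp ?D ?c' \<subseteq> supp ?D ?c"
  proof -
    have "x 1 = x 2" if x: "x \<in> ?D" and sum: "f x + x n = 0" for x
    proof -
      have "x n \<noteq> 0"
        using f_1[OF x] sum by force
      moreover from this sum have "f x \<noteq> 0"
        by auto
      ultimately show ?thesis
        using x_minus_1[of x 1] x_minus_1[of x 2] assms(2) by simp
    qed
    then show ?thesis
      by (auto simp: supp_def dot)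
  qed
  moreover have "?c (v 1 0 0) * ?c' (v 1 1 0) \<noteq> ?c (v 1 1 0) * ?c' (v 1 0 0)"
    using v_nonzero f_1 by (simp add: dot v_nth v_nth[unfolded One_nat_def])
  ultimately show ?thesis
    using v_nonzero
    by (intro not_minimal_codeI[of ?c _ ?c' _ "v 1 0 0" "v 1 1 0"] code_ofI v) auto
qed

theorem proposition5p3:
  fixes t :: ideal_type
    and p m n :: nat
    and I :: "nat multiset"
    and f :: "(nat \<Rightarrow> 'p::prime_card mod_ring) \<Rightarrow> 'p mod_ring"
  assumes "p = CARD('p)" and "odd p"
    and "1 \<le> m" and "m \<le> n"
    and "gen_order_ideal t p m n I"
    and "set_mset I = {1..n}" and "\<forall>i. count I i \<in> {0, p - 1}"
    and "f = indicator (ideals_below t m n I - {zero_vec n})"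
  shows "(m = 1 \<longrightarrow> \<not> minimal_code (nonzero_vecs n) (code_of n f)) \<and>
         (m = n - 1 \<and> 2 \<le> m \<and> t = Saturated \<longrightarrow>
            \<not> minimal_code (nonzero_vecs n) (code_of n f))"
proof -
  have "count I i = count (ambient_mset p n) i" for i
  proof (cases "i \<in> {1..n}")
    case True
    with assms(6) have "count I i \<noteq> 0"
      by (metis not_in_iff)
    with assms(7) have "count I i = p - 1"
      by (metis insertE emptyE)
    with True show ?thesis
      by (simp add: count_ambient_mset)
  next
    case False
    with assms(6) have "count I i = 0"
      by (metis not_in_iff)
    with False show ?thesis
      unfolding count_ambient_mset by (simp only: if_False)
  qed
  then have "I = ambient_mset CARD('p) n"
    using assms(1) by (intro multiset_eqI) simp
  with assms not_minimal_code_if_m_eq_1[of n f t] not_minimal_code_if_m_eq_n_minus_1[of m n f]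
  show ?thesis
    by auto
qed

end
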